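(* Let $M_1$ be an atomic, left-cancellative, invertible-free monoid and let $M_2$ be a free $0$-monoid. Then for any map $\mathbf{x}:\mathcal{I}_{M_2}\to M_1\setminus\{e\}$, the $\mathbf{x}$-convolution $M_1\rtimes_{\mathbf{x}}M_2$ is an atomic, left-cancellative, invertible-free monoid. Moreover, if $M_1$ is a left-cancellative homogeneous monoid and $\operatorname{im}\mathbf{x}\subseteq\mathcal{I}_{M_1}$, then $M_1\rtimes_{\mathbf{x}}M_2$ is a left-cancellative homogeneous monoid.
   Context: A monoid $M$ with identity $e$ is left-cancellative if $ax=ay$ implies $x=y$; invertible-free if $xy=e$ implies $x=y=e$. An element is irreducible if it is not invertible and is not a product of two non-invertible elements; $\mathcal{I}_M$ is the set of irreducible elements. $M$ is atomic if every element is a finite (possibly empty) product of irreducibles. $M$ is homogeneous if it is atomic and any two factorizations $a_1\cdots a_n=b_1\cdots b_m$ of the same element into irreducibles have $n=m$. $\mathbf{F}(\mathbf{X})$ denotes the free monoid on a set $\mathbf{X}$. A free $0$-monoid $M_2$ is a free monoid with an additional zero element $0$ adjoined and some imposed relations of the form $W=0$, with $W$ words. It is presented as $\langle\mathcal{I}_{M_2}\cup\{0\}\mid R_{M_2}\rangle$, where $\mathcal{I}_{M_2}$ is its set of irreducible elements (the free generators) and $R_{M_2}$ consists of the relations making $0$ a zero element together with a set of relations $W=0$, $W\in\mathbf{F}(\mathcal{I}_{M_2})$. Let $M_1=\langle\mathcal{I}_{M_1}\mid R_{M_1}\rangle$ be atomic, left-cancellative and invertible-free, $M_2=\langle\mathcal{I}_{M_2}\cup\{0\}\mid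 R_{M_2}\rangle$ a free $0$-monoid, and $\mathbf{x}:\mathcal{I}_{M_2}\to M_1\setminus\{e\}$ a map. The $\mathbf{x}$-convolution $M_1\rtimes_{\mathbf{x}}M_2$ is the monoid with generating set $\mathcal{I}_{M_1}\sqcup\mathcal{I}_{M_2}$ and the defining relations: (1) all relations in $R_{M_1}$; (2) $y_iY_j=\mathbf{x}(y_i)Y_j$ whenever $y_i\in\mathcal{I}_{M_2}$, $Y_j\in\mathbf{F}(\mathcal{I}_{M_2})$ and the relation $y_iY_j=0$ is in $R_{M_2}$; (3) $y_ix_j=\mathbf{x}(y_i)x_j$ for all $y_i\in\mathcal{I}_{M_2}$, $x_j\in\mathcal{I}_{M_1}$. (Here $\mathbf{x}(y_i)$ is written as a word in $\mathcal{I}_{M_1}$; the result does not depend on the choice of presentations.) *)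

theory Defs
  imports "HOL-Algebra.Group"
begin

definition left_cancellative :: "('a, 'm) monoid_scheme \<Rightarrow> bool" where
  "left_cancellative M \<longleftrightarrow>
    (\<forall>a\<in>carrier M. \<forall>x\<in>carrier M. \<forall>y\<in>carrier M. a \<otimes>\<^bsub>M\<^esub> x = a \<otimes>\<^bsub>M\<^esub> y \<longrightarrow> x = y)"

definition invertible_free :: "('a, 'm) monoid_scheme \<Rightarrow> bool" where
  "invertible_free M \<longleftrightarrow>
    (\<forall>x\<in>carrier M. \<forall>y\<in>carrier M. x \<otimes>\<^bsub>M\<^esub> y = \<one>\<^bsub>M\<^esub> \<longrightarrow> x = \<one>\<^bsub>M\<^esub> \<and> y = \<one>\<^bsub>M\<^esub>)"

text \<open>The predicate \<open>irreducible\<close> of \<open>HOL-Algebra.Divisibility\<close> is phrased through one-sided proper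
  divisors and is intended for commutative monoids, so it is not used here.\<close>

definition irreds :: "('a, 'm) monoid_scheme \<Rightarrow> 'a set" where
  "irreds M = {a \<in> carrier M. a \<notin> Units M \<and>
    \<not> (\<exists>b\<in>carrier M - Units M. \<exists>c\<in>carrier M - Units M. a = b \<otimes>\<^bsub>M\<^esub> c)}"

definition word_prod :: "('a, 'm) monoid_scheme \<Rightarrow> 'a list \<Rightarrow> 'a" where
  "word_prod M w = foldr (\<lambda>a b. a \<otimes>\<^bsub>M\<^esub> b) w \<one>\<^bsub>M\<^esub>"

definition atomic :: "('a, 'm) monoid_scheme \<Rightarrow> bool" where
  "atomic M \<longleftrightarrow> (\<forall>a\<in>carrier M. \<exists>w\<in>lists (irreds M). word_prod M w = a)"

definition homogeneous :: "('a, 'm) monoid_scheme \<Rightarrow> bool" where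
  "homogeneous M \<longleftrightarrow> atomic M \<and>
    (\<forall>u\<in>lists (irreds M). \<forall>v\<in>lists (irreds M).
      word_prod M u = word_prod M v \<longrightarrow> length u = length v)"

text \<open>Monoid presentations. The free monoid on \<open>G\<close> is \<open>lists G\<close> under concatenation;
  \<open>pres_cong G R\<close> is the least congruence on it that contains the relations \<open>R\<close>.\<close>

inductive_set pres_cong :: "'g set \<Rightarrow> ('g list \<times> 'g list) set \<Rightarrow> ('g list \<times> 'g list) set"
  for G :: "'g set" and R :: "('g list \<times> 'g list) set" where
  rel: "(u, v) \<in> R \<Longrightarrow> u \<in> lists G \<Longrightarrow> v \<in> lists G \<Longrightarrow> (u, v) \<in> pres_cong G R"
| refl: "u \<in> lists G \<Longrightarrow> (u, u) \<in> pres_cong G R"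
| sym: "(u, v) \<in> pres_cong G R \<Longrightarrow> (v, u) \<in> pres_cong G R"
| trans: "(u, v) \<in> pres_cong G R \<Longrightarrow> (v, w) \<in> pres_cong G R \<Longrightarrow> (u, w) \<in> pres_cong G R"
| append: "(u, v) \<in> pres_cong G R \<Longrightarrow> (u', v') \<in> pres_cong G R
    \<Longrightarrow> (u @ u', v @ v') \<in> pres_cong G R"

definition presented_monoid :: "'g set \<Rightarrow> ('g list \<times> 'g list) set \<Rightarrow> 'g list set monoid" where
  "presented_monoid G R =
    \<lparr> carrier = lists G // pres_cong G R,
      mult = (\<lambda>A B. \<Union>u\<in>A. \<Union>v\<in>B. pres_cong G R `` {u @ v}),
      one = pres_cong G R `` {[]} \<rparr>"

text \<open>\<open>M = \<langle>G | R\<rangle>\<close> for a set \<open>G\<close> of elements of \<open>M\<close>: the evaluation map from the free monoid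
  on \<open>G\<close> to \<open>M\<close> is surjective and its kernel congruence is the one generated by \<open>R\<close>.\<close>

definition presentation_of ::
    "('a, 'm) monoid_scheme \<Rightarrow> 'a set \<Rightarrow> ('a list \<times> 'a list) set \<Rightarrow> bool" where
  "presentation_of M G R \<longleftrightarrow>
    G \<subseteq> carrier M \<and> R \<subseteq> lists G \<times> lists G \<and>
    (\<forall>a\<in>carrier M. \<exists>w\<in>lists G. word_prod M w = a) \<and>
    (\<forall>u\<in>lists G. \<forall>v\<in>lists G. word_prod M u = word_prod M v \<longleftrightarrow> (u, v) \<in> pres_cong G R)"

definition zero_rels :: "'a set \<Rightarrow> 'a \<Rightarrow> ('a list \<times> 'a list) set" where
  "zero_rels G z = {([z, g], [z]) | g. g \<in> G \<union> {z}} \<union> {([g, z], [z]) | g. g \<in> G \<union> {z}}"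

text \<open>\<open>M\<close> is a free 0-monoid with zero element \<open>z\<close>, presented as \<open>\<langle>irreds M \<union> {z} | R\<rangle>\<close>. Since the
  generators other than \<open>z\<close> are exactly the irreducible elements of \<open>M\<close>, no relation \<open>y = z\<close> with
  \<open>y\<close> a generator from \<open>irreds M\<close> can occur.\<close>

definition free_0_monoid ::
    "('a, 'm) monoid_scheme \<Rightarrow> 'a \<Rightarrow> ('a list \<times> 'a list) set \<Rightarrow> bool" where
  "free_0_monoid M z R \<longleftrightarrow> monoid M \<and>
    (\<exists>Ws \<subseteq> lists (irreds M). R = zero_rels (irreds M) z \<union> {(W, [z]) | W. W \<in> Ws}) \<and>
    presentation_of M (irreds M \<union> {z}) R"

text \<open>The three families of defining relations of the convolution. The word \<open>xw y\<close> in the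
  irreducibles of \<open>M1\<close> represents the element \<open>x(y)\<close>; the generating set is the disjoint union of
  the two sets of irreducibles, with \<open>M1\<close> on the left.\<close>

definition conv_rels ::
    "('a, 'm) monoid_scheme \<Rightarrow> ('a list \<times> 'a list) set \<Rightarrow>
     ('b, 'n) monoid_scheme \<Rightarrow> 'b \<Rightarrow> ('b list \<times> 'b list) set \<Rightarrow>
     ('b \<Rightarrow> 'a list) \<Rightarrow> (('a + 'b) list \<times> ('a + 'b) list) set" where
  "conv_rels M1 R1 M2 z R2 xw =
     {(map Inl u, map Inl v) | u v. (u, v) \<in> R1} \<union>
     {(map Inr (y # Y), map Inl (xw y) @ map Inr Y) | y Y.
        y \<in> irreds M2 \<and> Y \<in> lists (irreds M2) \<and> (y # Y, [z]) \<in> R2} \<union>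
     {([Inr y, Inl a], map Inl (xw y) @ [Inl a]) | y a. y \<in> irreds M2 \<and> a \<in> irreds M1}"

definition convolution ::
    "('a, 'm) monoid_scheme \<Rightarrow> ('a list \<times> 'a list) set \<Rightarrow>
     ('b, 'n) monoid_scheme \<Rightarrow> 'b \<Rightarrow> ('b list \<times> 'b list) set \<Rightarrow>
     ('b \<Rightarrow> 'a list) \<Rightarrow> ('a + 'b) list set monoid" where
  "convolution M1 R1 M2 z R2 xw =
     presented_monoid (Inl ` irreds M1 \<union> Inr ` irreds M2) (conv_rels M1 R1 M2 z R2 xw)"

end

theory Submission
  imports Defs "HOL-Library.Sublist"
begin

text \<open>Let the generators of the convolution act on pairs \<open>(m, W)\<close>, with \<open>m\<close> in \<open>M1\<close> and \<open>W\<close> a word in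
  the irreducibles of \<open>M2\<close>, the pair standing for the element \<open>m W\<close>. A generator of \<open>M1\<close> multiplies
  the first component; a generator \<open>y\<close> of \<open>M2\<close> is prepended to \<open>W\<close> if \<open>m\<close> is trivial and no prefix of
  \<open>y W\<close> is a zero relator, and otherwise acts as multiplication by \<open>x(y)\<close>. The defining relations
  hold for this action, so two words are congruent iff they send \<open>(\<one>, [])\<close> to the same pair.
  Each generator acts injectively and never produces \<open>(\<one>, [])\<close>, which gives left cancellation and
  invertible-freeness. The generators are irreducible, except for those \<open>y\<close> that are equal to
  \<open>x(y)\<close>. In the homogeneous case all defining relations preserve length.\<close>

section \<open>Presented monoids\<close>

declare in_lists_conv_set [simp del] in_listsI [rule del] in_listsD [rule del]

lemma pres_cong_in_lists:
  "(u, v) \<in> pres_cong G R \<Longrightarrow> u \<in> lists G \<and> v \<in> lists G"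
  by (induction rule: pres_cong.induct) auto

lemma equiv_pres_cong: "equiv (lists G) (pres_cong G R)"
proof (rule equivI)
  show "pres_cong G R \<subseteq> lists G \<times> lists G"
    by (auto dest: pres_cong_in_lists)
  show "refl_on (lists G) (pres_cong G R)"
    by (intro refl_onI) (rule pres_cong.refl)
  show "sym (pres_cong G R)" by (intro symI) (rule pres_cong.sym)
  show "trans (pres_cong G R)" by (intro transI) (rule pres_cong.trans)
qed

definition cls :: "'g set \<Rightarrow> ('g list \<times> 'g list) set \<Rightarrow> 'g list \<Rightarrow> 'g list set" where
  "cls G R w = pres_cong G R `` {w}"

lemma cls_eq_iff:
  assumes "u \<in> lists G" "v \<in> lists G"
  shows "cls G R u = cls G R v \<longleftrightarrow> (u, v) \<in> pres_cong G R"
  unfolding cls_def using eq_equiv_class_iff[OF equiv_pres_cong] assms by blast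

lemma carrier_presented: "carrier (presented_monoid G R) = cls G R ` lists G"
  by (auto simp: presented_monoid_def quotient_def cls_def)

lemma carrier_presentedE:
  assumes "a \<in> carrier (presented_monoid G R)"
  obtains w where "w \<in> lists G" "a = cls G R w"
  using assms unfolding carrier_presented by blast

lemma one_presented: "\<one>\<^bsub>presented_monoid G R\<^esub> = cls G R []"
  by (simp add: presented_monoid_def cls_def)

text \<open>The product is a union over all representatives of both factors. Since the relation is a
  congruence, every pair of representatives contributes the same class, so one pair computes
  it.\<close>

lemma mult_presented:
  assumes "u \<in> lists G" "v \<in> lists G"
  shows "cls G R u \<otimes>\<^bsub>presented_monoid G R\<^esub> cls G R v = cls G R (u @ v)"
proof -
  have self: "u \<in> cls G R u" "v \<in> cls G R v"
    using assms by (auto simp: cls_def intro: pres_cong.refl)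
  have "cls G R (u' @ v') = cls G R (u @ v)"
    if "u' \<in> cls G R u" "v' \<in> cls G R v" for u' v'
  proof -
    have "(u @ v, u' @ v') \<in> pres_cong G R"
      using that unfolding cls_def by (blast intro: pres_cong.append)
    then show ?thesis
      by (metis cls_eq_iff pres_cong_in_lists)
  qed
  then have "(\<Union>u'\<in>cls G R u. \<Union>v'\<in>cls G R v. cls G R (u' @ v')) = cls G R (u @ v)"
    using self by blast
  then show ?thesis
    by (simp add: presented_monoid_def cls_def)
qed

lemma monoid_presented: "monoid (presented_monoid G R)"
proof (rule monoidI)
  fix a b assume "a \<in> carrier (presented_monoid G R)" "b \<in> carrier (presented_monoid G R)"
  then show "a \<otimes>\<^bsub>presented_monoid G R\<^esub> b \<in> carrier (presented_monoid G R)"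
    by (elim carrier_presentedE) (simp add: mult_presented carrier_presented)
next
  show "\<one>\<^bsub>presented_monoid G R\<^esub> \<in> carrier (presented_monoid G R)"
    by (simp add: one_presented carrier_presented)
next
  fix a b c
  assume "a \<in> carrier (presented_monoid G R)" "b \<in> carrier (presented_monoid G R)"
    "c \<in> carrier (presented_monoid G R)"
  then show "a \<otimes>\<^bsub>presented_monoid G R\<^esub> b \<otimes>\<^bsub>presented_monoid G R\<^esub> c =
      a \<otimes>\<^bsub>presented_monoid G R\<^esub> (b \<otimes>\<^bsub>presented_monoid G R\<^esub> c)"
    by (elim carrier_presentedE) (simp add: mult_presented)
next
  fix a assume "a \<in> carrier (presented_monoid G R)"
  then show "\<one>\<^bsub>presented_monoid G R\<^esub> \<otimes>\<^bsub>presented_monoid G R\<^esub> a = a"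
    and "a \<otimes>\<^bsub>presented_monoid G R\<^esub> \<one>\<^bsub>presented_monoid G R\<^esub> = a"
    by (elim carrier_presentedE; simp add: mult_presented one_presented)+
qed

section \<open>Word products, irreducibles and units in a monoid\<close>

lemma word_prod_Nil [simp]: "word_prod M [] = \<one>\<^bsub>M\<^esub>"
  and word_prod_Cons [simp]: "word_prod M (a # w) = a \<otimes>\<^bsub>M\<^esub> word_prod M w"
  by (simp_all add: word_prod_def)

lemma (in monoid) word_prod_closed: "w \<in> lists (carrier G) \<Longrightarrow> word_prod G w \<in> carrier G"
  by (induction w) auto

lemma (in monoid) word_prod_append:
  "u \<in> lists (carrier G) \<Longrightarrow> v \<in> lists (carrier G) \<Longrightarrow>
    word_prod G (u @ v) = word_prod G u \<otimes> word_prod G v"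
  by (induction u) (auto simp: word_prod_closed m_assoc)

lemma word_prod_presented:
  "w \<in> lists G \<Longrightarrow> word_prod (presented_monoid G R) (map (\<lambda>g. cls G R [g]) w) = cls G R w"
  by (induction w) (auto simp: one_presented mult_presented)

lemma irreds_subset_carrier: "irreds M \<subseteq> carrier M"
  by (auto simp: irreds_def)

lemma lists_irreds_carrier: "w \<in> lists (irreds M) \<Longrightarrow> w \<in> lists (carrier M)"
  using lists_mono[OF irreds_subset_carrier] by blast

lemma (in monoid) one_notin_irreds: "\<one> \<notin> irreds G"
  by (auto simp: irreds_def)

lemma (in monoid) Units_invertible_free:
  assumes "invertible_free G"
  shows "Units G = {\<one>}"
proof -
  have "u = \<one>" if "u \<in> Units G" for u
    using assms that Units_l_inv[OF that] unfolding invertible_free_def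
    by (meson Units_closed Units_inv_closed)
  then show ?thesis by auto
qed

lemma (in monoid) word_prod_irreds_eq_one:
  assumes "invertible_free G" "w \<in> lists (irreds G)" "word_prod G w = \<one>"
  shows "w = []"
proof (cases w)
  case (Cons a v)
  then have "a \<in> irreds G" "a \<in> carrier G" "word_prod G v \<in> carrier G"
    using assms(2) irreds_subset_carrier[of G] by (auto intro!: word_prod_closed lists_irreds_carrier)
  moreover have "a \<otimes> word_prod G v = \<one>"
    using assms(3) Cons by simp
  ultimately have "a = \<one>"
    using assms(1) unfolding invertible_free_def by blast
  then show ?thesis
    using \<open>a \<in> irreds G\<close> one_notin_irreds by simp
qed simp

text \<open>Replace every letter of a word in the generators by a factorization of it and
  concatenate. The generators themselves may be reducible, as happens in the convolution for a
  letter \<open>y\<close> that equals \<open>x(y)\<close>.\<close>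

lemma (in monoid) atomic_of_generators:
  assumes closed: "G' \<subseteq> carrier G"
    and gen: "\<And>a. a \<in> carrier G \<Longrightarrow> \<exists>w\<in>lists G'. word_prod G w = a"
    and fact: "\<And>g. g \<in> G' \<Longrightarrow> \<exists>w\<in>lists (irreds G). word_prod G w = g"
  shows "atomic G"
proof -
  have "\<exists>v\<in>lists (irreds G). word_prod G v = word_prod G w" if "w \<in> lists G'" for w
    using that
  proof (induction w)
    case (Cons g w)
    then obtain v u where "v \<in> lists (irreds G)" "word_prod G v = word_prod G w"
      "u \<in> lists (irreds G)" "word_prod G u = g"
      using fact by blast
    then show ?case
      by (intro bexI[of _ "u @ v"]) (auto simp: word_prod_append lists_irreds_carrier)
  qed (auto intro: bexI[of _ "[]"])
  then show ?thesis
    unfolding atomic_def using gen by metis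
qed

text \<open>Concatenating factorizations of \<open>a\<close> and \<open>b\<close> factors the
  identity, whose factorizations all have length 0. This supplies invertible-freeness in the second
  half of the theorem, where it is not assumed.\<close>

lemma homogeneous_invertible_free:
  assumes "monoid M" "homogeneous M"
  shows "invertible_free M"
  unfolding invertible_free_def
proof (intro ballI impI)
  interpret monoid M by fact
  fix a b assume ab: "a \<in> carrier M" "b \<in> carrier M" "a \<otimes>\<^bsub>M\<^esub> b = \<one>\<^bsub>M\<^esub>"
  then obtain u v where uv: "u \<in> lists (irreds M)" "word_prod M u = a"
      "v \<in> lists (irreds M)" "word_prod M v = b"
    using assms(2) unfolding homogeneous_def atomic_def by metis
  then have "word_prod M (u @ v) = word_prod M []"
    using ab by (auto simp: word_prod_append lists_irreds_carrier)
  then have "length (u @ v) = length ([] :: 'a list)"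
    using assms(2) uv unfolding homogeneous_def by (metis append_in_lists_conv lists.Nil)
  then show "a = \<one>\<^bsub>M\<^esub> \<and> b = \<one>\<^bsub>M\<^esub>"
    using uv by auto
qed

section \<open>Presentations whose relations preserve length\<close>

lemma pres_cong_length:
  assumes "\<And>u v. (u, v) \<in> R \<Longrightarrow> length u = length v"
  shows "(u, v) \<in> pres_cong G R \<Longrightarrow> length u = length v"
  by (induction rule: pres_cong.induct) (auto simp: assms)

text \<open>The length of a word depends only on its class. Hence only the empty word represents a
  unit, every irreducible is the class of a single generator, and a product of \<open>n\<close>
  irreducibles is represented by a word of length \<open>n\<close>.\<close>

lemma homogeneous_presented:
  assumes len: "\<And>u v. (u, v) \<in> R \<Longrightarrow> length u = length v"
    and "atomic (presented_monoid G R)"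
  shows "homogeneous (presented_monoid G R)"
proof -
  let ?P = "presented_monoid G R"
  interpret P: monoid ?P by (rule monoid_presented)
  have len_eq: "length u = length v" if "u \<in> lists G" "v \<in> lists G" "cls G R u = cls G R v" for u v
    using that pres_cong_length[of R u v G, OF len] by (simp add: cls_eq_iff)
  \<comment> \<open>A left inverse \<open>v\<close> makes \<open>v @ w\<close> congruent to
    \<open>[]\<close>, and congruent words have equal length.\<close>
  have unit: "w = []" if w: "w \<in> lists G" and wU: "cls G R w \<in> Units ?P" for w
  proof -
    obtain b where "b \<in> carrier ?P" "b \<otimes>\<^bsub>?P\<^esub> cls G R w = \<one>\<^bsub>?P\<^esub>"
      using wU unfolding Units_def by blast
    moreover then obtain v where "v \<in> lists G" "b = cls G R v"
      by (elim carrier_presentedE)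
    ultimately have "v \<in> lists G" "cls G R (v @ w) = cls G R []"
      using w by (simp_all add: mult_presented one_presented)
    then show "w = []"
      using len_eq[of "v @ w" "[]"] w by auto
  qed
  have one: "\<exists>g\<in>G. a = cls G R [g]" if a: "a \<in> irreds ?P" for a
  proof -
    obtain w where w: "w \<in> lists G" "a = cls G R w"
      using a irreds_subset_carrier[of ?P] by (blast elim: carrier_presentedE)
    have "w \<noteq> []"
      using a w P.one_notin_irreds by (auto simp: one_presented)
    then obtain g v where gv: "w = g # v" by (cases w) auto
    then have ing: "g \<in> G" "v \<in> lists G" using w by auto
    then have "a = cls G R [g] \<otimes>\<^bsub>?P\<^esub> cls G R v"
      using w gv by (simp add: mult_presented)
    moreover have "cls G R [g] \<in> carrier ?P - Units ?P"
      using ing unit[of "[g]"] by (auto simp: carrier_presented)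
    \<comment> \<open>The first letter is not a unit, so irreducibility forces the rest of the word
      to be one.\<close>
    ultimately have "cls G R v \<in> Units ?P"
      using a ing by (auto simp: irreds_def carrier_presented)
    then have "v = []"
      using unit ing by blast
    then show ?thesis
      using w gv ing by auto
  qed
  have word: "\<exists>w\<in>lists G. length w = length as \<and> word_prod ?P as = cls G R w"
    if "as \<in> lists (irreds ?P)" for as
    using that
  proof (induction as)
    case Nil
    then show ?case by (auto simp: one_presented)
  next
    case (Cons a as)
    then obtain g w where "g \<in> G" "a = cls G R [g]" "w \<in> lists G"
      "length w = length as" "word_prod ?P as = cls G R w"
      using one by blast
    then show ?case
      by (intro bexI[of _ "g # w"]) (auto simp: mult_presented)
  qed
  show ?thesis
    unfolding homogeneous_def using assms(2) word len_eq by metis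
qed

section \<open>The action on normal forms\<close>

text \<open>The common setting of both halves of the theorem. The map \<open>x\<close> enters only
  through the words \<open>xw y\<close> spelling its values; left cancellation and homogeneity are
  hypotheses of the lemmas that use them.\<close>

locale convolution_data = monoid M1
  for M1 :: "('a, 'm) monoid_scheme" (structure) and R1 :: "('a list \<times> 'a list) set"
    and M2 :: "('b, 'n) monoid_scheme" and z :: 'b and R2 :: "('b list \<times> 'b list) set"
    and xw :: "'b \<Rightarrow> 'a list" +
  assumes presentation: "presentation_of M1 (irreds M1) R1"
    and inv_free: "invertible_free M1"
    and xw_in: "y \<in> irreds M2 \<Longrightarrow> xw y \<in> lists (irreds M1)"
    and xw_ne: "y \<in> irreds M2 \<Longrightarrow> word_prod M1 (xw y) \<noteq> \<one>"
begin

abbreviation gens :: "('a + 'b) set" where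
  "gens \<equiv> Inl ` irreds M1 \<union> Inr ` irreds M2"

abbreviation rels :: "(('a + 'b) list \<times> ('a + 'b) list) set" where
  "rels \<equiv> conv_rels M1 R1 M2 z R2 xw"

abbreviation cong (infix "\<approx>" 50) where
  "u \<approx> v \<equiv> (u, v) \<in> pres_cong gens rels"

abbreviation xval :: "'b \<Rightarrow> 'a" where
  "xval y \<equiv> word_prod M1 (xw y)"

text \<open>Relation (2) applies at the front of \<open>y # W\<close> and turns \<open>y\<close>
  into \<open>x(y)\<close>. The word \<open>Y\<close> may be empty; then \<open>y\<close> itself is
  identified with \<open>x(y)\<close>.\<close>

definition collapses :: "'b \<Rightarrow> 'b list \<Rightarrow> bool" where
  "collapses y W \<longleftrightarrow> (\<exists>Y \<in> lists (irreds M2). (y # Y, [z]) \<in> R2 \<and> prefix Y W)"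

text \<open>Left multiplication in the convolution, read on pairs. If \<open>m\<close> is not
  trivial, relation (3) lets its first letter turn \<open>y\<close> into \<open>x(y)\<close>; if
  \<open>m\<close> is trivial, only relation (2) can do so.\<close>

fun act :: "'a + 'b \<Rightarrow> 'a \<times> 'b list \<Rightarrow> 'a \<times> 'b list" where
  "act (Inl a) (m, W) = (a \<otimes> m, W)"
| "act (Inr y) (m, W) = (if m = \<one> \<and> \<not> collapses y W then (\<one>, y # W) else (xval y \<otimes> m, W))"

abbreviation acts :: "('a + 'b) list \<Rightarrow> 'a \<times> 'b list \<Rightarrow> 'a \<times> 'b list" where
  "acts \<equiv> foldr act"

abbreviation nf :: "('a + 'b) list \<Rightarrow> 'a \<times> 'b list" where
  "nf w \<equiv> acts w (\<one>, [])"

lemma map_Inl_in [simp]: "u \<in> lists (irreds M1) \<Longrightarrow> map Inl u \<in> lists gens"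
  and map_Inr_in [simp]: "W \<in> lists (irreds M2) \<Longrightarrow> map Inr W \<in> lists gens"
  by (auto simp: in_lists_conv_set)

lemma irreds_closed [simp]: "a \<in> irreds M1 \<Longrightarrow> a \<in> carrier M1"
  using irreds_subset_carrier[of M1] by blast

lemma word_prod_irreds_closed [simp]:
  "w \<in> lists (irreds M1) \<Longrightarrow> word_prod M1 w \<in> carrier M1"
  by (intro word_prod_closed lists_irreds_carrier)

lemma xval_closed [simp]: "y \<in> irreds M2 \<Longrightarrow> xval y \<in> carrier M1"
  using xw_in word_prod_irreds_closed by blast

lemma mult_eq_one:
  "a \<in> carrier M1 \<Longrightarrow> b \<in> carrier M1 \<Longrightarrow> a \<otimes> b = \<one> \<longleftrightarrow> a = \<one> \<and> b = \<one>"
  using inv_free unfolding invertible_free_def by (metis l_one one_closed)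

lemma irreducible_factor:
  assumes "a \<otimes> b \<in> irreds M1" "a \<in> carrier M1" "b \<in> carrier M1"
  shows "a = \<one> \<or> b = \<one>"
  using assms Units_invertible_free[OF inv_free] unfolding irreds_def by blast

lemma fst_act_closed:
  "g \<in> gens \<Longrightarrow> fst p \<in> carrier M1 \<Longrightarrow> fst (act g p) \<in> carrier M1"
  by (cases p) auto

lemma fst_acts_closed:
  "w \<in> lists gens \<Longrightarrow> fst p \<in> carrier M1 \<Longrightarrow> fst (acts w p) \<in> carrier M1"
  by (induction w) (auto simp del: Un_iff intro: fst_act_closed)

lemma acts_Inl:
  "u \<in> lists (irreds M1) \<Longrightarrow> m \<in> carrier M1 \<Longrightarrow>
    acts (map Inl u) (m, W) = (word_prod M1 u \<otimes> m, W)"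
  by (induction u) (auto simp: m_assoc)

text \<open>Once a letter acts as multiplication by \<open>xval y\<close>, the first component is
  nontrivial and stays so, because \<open>M1\<close> is invertible-free. A trivial result therefore
  means that every letter was prepended. For relation (2) this shows that \<open>Y\<close> is still
  visible as a prefix when \<open>y\<close> acts.\<close>

lemma acts_Inr_trivial:
  assumes "Y \<in> lists (irreds M2)" "m \<in> carrier M1" "fst (acts (map Inr Y) (m, W)) = \<one>"
  shows "m = \<one> \<and> acts (map Inr Y) (m, W) = (\<one>, Y @ W)"
  using assms
proof (induction Y rule: list.induct)
  case (Cons y Y)
  define p where "p = acts (map Inr Y) (m, W)"
  have "map Inr Y \<in> lists gens"
    using Cons.prems by simp
  then have "fst p \<in> carrier M1"
    unfolding p_def using Cons.prems by (intro fst_acts_closed) auto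
  moreover have "fst (act (Inr y) p) = \<one>" "y \<in> irreds M2"
    using Cons.prems by (auto simp: p_def)
  ultimately have "fst p = \<one>" and *: "act (Inr y) p = (\<one>, y # snd p)"
    using xw_ne by (cases p; auto simp: mult_eq_one split: if_splits)+
  then have "m = \<one>" "p = (\<one>, Y @ W)"
    using Cons unfolding p_def by auto
  moreover have "acts (map Inr (y # Y)) (m, W) = act (Inr y) p"
    by (simp add: p_def)
  ultimately show ?case
    using * by simp
qed auto

lemma acts_rels:
  assumes "(u, v) \<in> rels" "fst p \<in> carrier M1"
  shows "acts u p = acts v p"
proof -
  obtain m W where p: "p = (m, W)" "m \<in> carrier M1"
    using assms(2) by (cases p) auto
  consider (M1) u' v' where "u = map Inl u'" "v = map Inl v'" "(u', v') \<in> R1"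
    | (zero) y Y where "u = map Inr (y # Y)" "v = map Inl (xw y) @ map Inr Y"
        "y \<in> irreds M2" "Y \<in> lists (irreds M2)" "(y # Y, [z]) \<in> R2"
    | (mixed) y a where "u = [Inr y, Inl a]" "v = map Inl (xw y) @ [Inl a]"
        "y \<in> irreds M2" "a \<in> irreds M1"
    using assms(1) unfolding conv_rels_def by blast
  then show ?thesis
  proof cases
    case M1
    then have "u' \<in> lists (irreds M1)" "v' \<in> lists (irreds M1)"
      using presentation unfolding presentation_of_def by auto
    moreover from this have "word_prod M1 u' = word_prod M1 v'"
      using presentation pres_cong.rel[OF M1(3)] unfolding presentation_of_def by blast
    ultimately show ?thesis
      using M1 p by (simp add: acts_Inl)
  next
    case zero
    obtain m' W' where q: "acts (map Inr Y) p = (m', W')"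
      by (cases "acts (map Inr Y) p")
    have "map Inr Y \<in> lists gens"
      using zero by (intro map_Inr_in)
    then have m': "m' \<in> carrier M1"
      using fst_acts_closed[of "map Inr Y" p] q p by auto
    \<comment> \<open>Whether or not \<open>m'\<close> is trivial, \<open>y\<close> now acts as
      multiplication by \<open>xval y\<close>: a trivial \<open>m'\<close> means that all of
      \<open>Y\<close> was prepended, and then \<open>y # Y\<close> is a zero relator.\<close>
    have "collapses y W'" if "m' = \<one>"
    proof -
      have "W' = Y @ W"
        using acts_Inr_trivial[OF zero(4) p(2), of W] q p that by auto
      then show ?thesis
        using zero by (auto simp: collapses_def)
    qed
    then show ?thesis
      using zero q m' xw_in by (auto simp: acts_Inl)
  next
    case mixed
    \<comment> \<open>This excludes the prepending branch, so \<open>y\<close> acts as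
      multiplication by \<open>xval y\<close>.\<close>
    then have "a \<otimes> m \<noteq> \<one>"
      using p one_notin_irreds by (auto simp: mult_eq_one)
    then show ?thesis
      using mixed p xw_in by (auto simp: acts_Inl)
  qed
qed

text \<open>The pair \<open>p\<close> stays arbitrary in the induction: in a concatenation the left
  word acts on the image of \<open>p\<close> under the right word.\<close>

lemma acts_cong: "u \<approx> v \<Longrightarrow> fst p \<in> carrier M1 \<Longrightarrow> acts u p = acts v p"
proof (induction arbitrary: p rule: pres_cong.induct)
  case (rel u v)
  then show ?case by (intro acts_rels)
next
  case (append u v u' v')
  have "fst (acts v' p) \<in> carrier M1"
    using append.hyps append.prems pres_cong_in_lists by (blast intro: fst_acts_closed)
  then show ?case
    using append.IH append.prems by simp
qed auto

section \<open>Reduction of words to normal form\<close>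

lemma cong_append_right: "u \<approx> v \<Longrightarrow> w \<in> lists gens \<Longrightarrow> u @ w \<approx> v @ w"
  by (intro pres_cong.append pres_cong.refl)

lemma cong_Cons: "u \<approx> v \<Longrightarrow> g \<in> gens \<Longrightarrow> g # u \<approx> g # v"
  using pres_cong.append[of "[g]" "[g]" gens rels u v] by (auto intro: pres_cong.refl)

lemma cong_map_Inl: "(u, v) \<in> pres_cong (irreds M1) R1 \<Longrightarrow> map Inl u \<approx> map Inl v"
proof (induction rule: pres_cong.induct)
  case (rel u v)
  then have "(map Inl u, map Inl v) \<in> rels"
    by (auto simp: conv_rels_def)
  then show ?case
    using rel by (intro pres_cong.rel) simp_all
next
  case (refl u)
  then show ?case by (intro pres_cong.refl) simp
next
  case (sym u v)
  then show ?case by (blast intro: pres_cong.sym)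
next
  case (trans u v w)
  then show ?case by (blast intro: pres_cong.trans)
next
  case (append u v u' v')
  then show ?case by (auto intro: pres_cong.append)
qed

lemma cong_mixed:
  assumes "y \<in> irreds M2" "a \<in> irreds M1"
  shows "[Inr y, Inl a] \<approx> map Inl (xw y) @ [Inl a]"
proof (rule pres_cong.rel)
  show "([Inr y, Inl a], map Inl (xw y) @ [Inl a]) \<in> rels"
    using assms by (auto simp: conv_rels_def)
qed (use assms xw_in in auto)

lemma cong_collapse:
  assumes "y \<in> irreds M2" "W \<in> lists (irreds M2)" "collapses y W"
  shows "map Inr (y # W) \<approx> map Inl (xw y) @ map Inr W"
proof -
  obtain Y Z where Y: "Y \<in> lists (irreds M2)" "(y # Y, [z]) \<in> R2" "W = Y @ Z"
    using assms(3) unfolding collapses_def prefix_def by blast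
  have "(map Inr (y # Y), map Inl (xw y) @ map Inr Y) \<in> rels"
    using Y assms(1) unfolding conv_rels_def by blast
  moreover have "map Inr (y # Y) \<in> lists gens" "map Inl (xw y) @ map Inr Y \<in> lists gens"
    using Y(1) assms(1) xw_in by auto
  ultimately have "map Inr (y # Y) \<approx> map Inl (xw y) @ map Inr Y"
    by (rule pres_cong.rel)
  moreover have "map Inr Z \<in> lists gens"
    using Y assms by auto
  ultimately have "map Inr (y # Y) @ map Inr Z \<approx> (map Inl (xw y) @ map Inr Y) @ map Inr Z"
    by (rule cong_append_right)
  then show ?thesis
    using Y(3) by simp
qed

text \<open>Letters are added on the left, in the order in which \<open>foldr\<close> applies them,
  and each branch of \<open>act\<close> is realized by a defining relation. Only the value of
  \<open>u\<close> is determined by the pair, not \<open>u\<close> itself.\<close>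

lemma cong_nf:
  "w \<in> lists gens \<Longrightarrow> \<exists>u\<in>lists (irreds M1). \<exists>W\<in>lists (irreds M2).
    nf w = (word_prod M1 u, W) \<and> w \<approx> map Inl u @ map Inr W"
proof (induction w)
  case Nil
  then show ?case
    by (intro bexI[of _ "[]"]) (auto intro: pres_cong.refl)
next
  case (Cons g w)
  then obtain u W where u: "u \<in> lists (irreds M1)" and W: "W \<in> lists (irreds M2)"
    and nf: "nf w = (word_prod M1 u, W)" and eq: "w \<approx> map Inl u @ map Inr W"
    by auto
  have g: "g \<in> gens"
    using Cons.prems by auto
  have step: "g # w \<approx> g # map Inl u @ map Inr W"
    using eq g by (rule cong_Cons)
  show ?case
  proof (cases g)
    case (Inl a)
    then show ?thesis
      using u W nf step g by (intro bexI[of _ "a # u"] bexI[of _ W]) auto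
  next
    case (Inr y)
    then have y: "y \<in> irreds M2"
      using g by auto
    \<comment> \<open>The cases on \<open>u\<close> match the test for a trivial first component in
      \<open>act\<close>, since a nonempty product of irreducibles is never trivial.\<close>
    show ?thesis
    proof (cases u)
      case Nil
      show ?thesis
      proof (cases "collapses y W")
        case True
        have "g # w \<approx> map Inl (xw y) @ map Inr W"
          using step cong_collapse[OF y W True] Nil Inr by (auto intro: pres_cong.trans)
        then show ?thesis
          using xw_in[OF y] W nf Nil Inr True y
          by (intro bexI[of _ "xw y"] bexI[of _ W]) auto
      next
        case False
        then show ?thesis
          using W y nf Nil Inr step by (intro bexI[of _ "[]"] bexI[of _ "y # W"]) auto
      qed
    next
      case (Cons a u')
      have a: "a \<in> irreds M1" "u' \<in> lists (irreds M1)"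
        using u Cons by auto
      have "map Inl u' @ map Inr W \<in> lists gens"
        using a(2) W by auto
      from cong_append_right[OF cong_mixed[OF y a(1)] this]
      have "g # w \<approx> map Inl (xw y @ u) @ map Inr W"
        using step Inr Cons by (auto intro: pres_cong.trans)
      moreover have "word_prod M1 u \<noteq> \<one>"
        using word_prod_irreds_eq_one[OF inv_free u] Cons by auto
      moreover have "word_prod M1 (xw y @ u) = xval y \<otimes> word_prod M1 u"
        using xw_in[OF y] u by (intro word_prod_append lists_irreds_carrier)
      ultimately show ?thesis
        using xw_in[OF y] u W nf Inr
        by (intro bexI[of _ "xw y @ u"] bexI[of _ W]) auto
    qed
  qed
qed

text \<open>The action respects congruence. Conversely, equal pairs give normal forms with the same
  \<open>M2\<close>-part and with \<open>M1\<close>-parts of equal value, which are congruent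
  because \<open>R1\<close> presents \<open>M1\<close>.\<close>

lemma cong_iff_nf:
  assumes "u \<in> lists gens" "v \<in> lists gens"
  shows "u \<approx> v \<longleftrightarrow> nf u = nf v"
proof
  assume "u \<approx> v"
  then show "nf u = nf v" by (intro acts_cong) auto
next
  assume eq: "nf u = nf v"
  obtain u' W where u': "u' \<in> lists (irreds M1)" and W: "W \<in> lists (irreds M2)"
      "nf u = (word_prod M1 u', W)" "u \<approx> map Inl u' @ map Inr W"
    using cong_nf[OF assms(1)] by blast
  obtain v' V where v': "v' \<in> lists (irreds M1)"
      "nf v = (word_prod M1 v', V)" "v \<approx> map Inl v' @ map Inr V"
    using cong_nf[OF assms(2)] by blast
  have "V = W" "word_prod M1 u' = word_prod M1 v'"
    using eq W v' by auto
  then have "(u', v') \<in> pres_cong (irreds M1) R1"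
    using u' v'(1) presentation unfolding presentation_of_def by blast
  then have "map Inl u' @ map Inr W \<approx> map Inl v' @ map Inr W"
    using W(1) by (intro cong_append_right cong_map_Inl) auto
  then show "u \<approx> v"
    using W(3) v'(3) \<open>V = W\<close> by (blast intro: pres_cong.sym pres_cong.trans)
qed

section \<open>The trivial pair and injectivity of the action\<close>

lemma fst_nf_closed: "w \<in> lists gens \<Longrightarrow> fst (nf w) \<in> carrier M1"
  by (intro fst_acts_closed) auto

lemma act_ne_trivial:
  "g \<in> gens \<Longrightarrow> fst p \<in> carrier M1 \<Longrightarrow> act g p \<noteq> (\<one>, [])"
  using one_notin_irreds xw_ne by (cases p) (auto simp: mult_eq_one split: if_splits)

lemma acts_eq_trivial:
  assumes "w \<in> lists gens" "fst p \<in> carrier M1" "acts w p = (\<one>, [])"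
  shows "w = [] \<and> p = (\<one>, [])"
proof (cases w)
  case (Cons g v)
  then have "act g (acts v p) \<noteq> (\<one>, [])"
    using assms by (intro act_ne_trivial fst_acts_closed) auto
  then show ?thesis
    using assms(3) Cons by simp
qed (use assms in auto)

text \<open>Multiplication is injective by left cancellation in \<open>M1\<close>, and prepending is
  injective as well. The two branches for \<open>Inr y\<close> have disjoint ranges: one leaves the
  first component trivial, the other makes it nontrivial.\<close>

lemma act_inj:
  assumes "left_cancellative M1" "g \<in> gens" "fst p \<in> carrier M1" "fst q \<in> carrier M1"
    "act g p = act g q"
  shows "p = q"
proof -
  have canc: "b = c" if "a \<otimes> b = a \<otimes> c" "a \<in> carrier M1" "b \<in> carrier M1" "c \<in> carrier M1" for a b c
    using assms(1) that unfolding left_cancellative_def by blast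
  obtain m W n V where pq: "p = (m, W)" "q = (n, V)"
    by (cases p, cases q)
  have mn: "m \<in> carrier M1" "n \<in> carrier M1"
    using assms pq by auto
  show ?thesis
  proof (cases g)
    case (Inl a)
    then show ?thesis
      using assms pq canc[of a m n] mn by auto
  next
    case (Inr y)
    then have y: "xval y \<in> carrier M1" "xval y \<noteq> \<one>"
      using assms xw_ne by auto
    have "xval y \<otimes> m \<noteq> \<one>" "xval y \<otimes> n \<noteq> \<one>" "\<one> \<noteq> xval y \<otimes> n"
      using mult_eq_one[OF y(1)] y mn by metis+
    then show ?thesis
      using assms(5) pq Inr canc[OF _ y(1) mn] by (auto split: if_splits)
  qed
qed

lemma acts_inj:
  assumes "left_cancellative M1" "w \<in> lists gens" "fst p \<in> carrier M1" "fst q \<in> carrier M1"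
    "acts w p = acts w q"
  shows "p = q"
  using assms(2,5)
proof (induction w)
  case (Cons g w)
  then have "acts w p = acts w q"
    using assms by (intro act_inj[of g "acts w p" "acts w q"] fst_acts_closed) auto
  then show ?case
    using Cons by auto
qed auto

section \<open>Properties of the convolution\<close>

abbreviation P where "P \<equiv> convolution M1 R1 M2 z R2 xw"

abbreviation c where "c \<equiv> cls gens rels"

lemma monoid_P: "monoid P"
  unfolding convolution_def by (rule monoid_presented)

lemma carrier_P: "carrier P = c ` lists gens"
  unfolding convolution_def by (rule carrier_presented)

lemma one_P: "\<one>\<^bsub>P\<^esub> = c []"
  unfolding convolution_def by (rule one_presented)

lemma mult_P: "u \<in> lists gens \<Longrightarrow> v \<in> lists gens \<Longrightarrow> c u \<otimes>\<^bsub>P\<^esub> c v = c (u @ v)"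
  unfolding convolution_def by (rule mult_presented)

lemma word_prod_P: "w \<in> lists gens \<Longrightarrow> word_prod P (map (\<lambda>g. c [g]) w) = c w"
  unfolding convolution_def by (rule word_prod_presented)

lemma c_eq_iff: "u \<in> lists gens \<Longrightarrow> v \<in> lists gens \<Longrightarrow> c u = c v \<longleftrightarrow> nf u = nf v"
  by (metis cls_eq_iff cong_iff_nf)

section \<open>Invertible-freeness and left cancellation\<close>

lemma invertible_free_P: "invertible_free P"
  unfolding invertible_free_def carrier_P
proof (intro ballI impI, elim imageE)
  fix a b u v
  assume uv: "a = c u" "u \<in> lists gens" "b = c v" "v \<in> lists gens" "a \<otimes>\<^bsub>P\<^esub> b = \<one>\<^bsub>P\<^esub>"
  then have "c (u @ v) = c []"
    by (simp add: mult_P one_P)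
  then have "nf (u @ v) = (\<one>, [])"
    using uv c_eq_iff[of "u @ v" "[]"] by (simp del: foldr_append)
  then have "u @ v = []"
    using acts_eq_trivial[of "u @ v" "(\<one>, [])"] uv by (simp del: foldr_append)
  then show "a = \<one>\<^bsub>P\<^esub> \<and> b = \<one>\<^bsub>P\<^esub>"
    using uv by (simp add: one_P)
qed

lemma left_cancellative_P:
  assumes "left_cancellative M1"
  shows "left_cancellative P"
  unfolding left_cancellative_def carrier_P
proof (intro ballI impI, elim imageE)
  fix a b d u v w
  assume uvw: "a = c u" "u \<in> lists gens" "b = c v" "v \<in> lists gens" "d = c w" "w \<in> lists gens"
    "a \<otimes>\<^bsub>P\<^esub> b = a \<otimes>\<^bsub>P\<^esub> d"
  then have "c (u @ v) = c (u @ w)"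
    by (simp add: mult_P)
  then have "nf (u @ v) = nf (u @ w)"
    using uvw c_eq_iff[of "u @ v" "u @ w"] by (simp del: foldr_append)
  then have "acts u (nf v) = acts u (nf w)"
    by simp
  then have "nf v = nf w"
    by (rule acts_inj[OF assms uvw(2) fst_nf_closed[OF uvw(4)] fst_nf_closed[OF uvw(6)]])
  then show "b = d"
    using uvw c_eq_iff[of v w] by (simp)
qed

section \<open>Irreducible elements and atomicity\<close>

text \<open>The hypothesis \<open>cover\<close> says that \<open>nf w\<close> is reached in one step
  only from the trivial pair. If \<open>c w\<close> is a product whose left factor starts with
  \<open>g\<close>, then \<open>g\<close> makes the last step, so the pair before it is trivial, and
  hence so is the right factor.\<close>

lemma irreducible_if_cover:
  assumes w: "w \<in> lists gens" "nf w \<noteq> (\<one>, [])"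
    and cover: "\<And>g p. g \<in> gens \<Longrightarrow> fst p \<in> carrier M1 \<Longrightarrow> act g p = nf w \<Longrightarrow> p = (\<one>, [])"
  shows "c w \<in> irreds P"
proof -
  interpret P: monoid P by (rule monoid_P)
  have units: "Units P = {c []}"
    using P.Units_invertible_free[OF invertible_free_P] by (simp add: one_P)
  have "c w \<noteq> c []"
    using w c_eq_iff[of w "[]"] by auto
  moreover have "c u = c [] \<or> c v = c []"
    if uv: "u \<in> lists gens" "v \<in> lists gens" "c w = c u \<otimes>\<^bsub>P\<^esub> c v" for u v
  proof (cases u)
    case (Cons g u')
    have u': "g \<in> gens" "u' \<in> lists gens"
      using uv Cons by auto
    have "c w = c (u @ v)"
      using uv by (simp add: mult_P)
    then have "nf w = nf (u @ v)"
      using w uv c_eq_iff[of w "u @ v"] by (simp del: foldr_append)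
    then have "act g (acts u' (nf v)) = nf w"
      using Cons by simp
    then have "acts u' (nf v) = (\<one>, [])"
      using u' uv by (intro cover[of g] fst_acts_closed fst_nf_closed)
    then have "nf v = (\<one>, [])"
      using acts_eq_trivial[OF u'(2) fst_nf_closed[OF uv(2)]] by blast
    then show ?thesis
      using uv c_eq_iff[of v "[]"] by simp
  qed simp
  ultimately show ?thesis
    using w unfolding irreds_def units carrier_P by auto
qed

text \<open>As \<open>a\<close> is nontrivial, the last step to \<open>(a, [])\<close> is not a
  prepending; it multiplies some \<open>m\<close> by a nontrivial element of \<open>M1\<close>.
  Irreducibility of \<open>a\<close> then makes \<open>m\<close> trivial.\<close>

lemma Inl_irreducible:
  assumes a: "a \<in> irreds M1"
  shows "c [Inl a] \<in> irreds P"
proof (rule irreducible_if_cover)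
  show "[Inl a] \<in> lists gens" "nf [Inl a] \<noteq> (\<one>, [])"
    using a one_notin_irreds by auto
next
  fix g :: "'a + 'b" and p :: "'a \<times> 'b list"
  assume g: "g \<in> gens" and p: "fst p \<in> carrier M1" and eq: "act g p = nf [Inl a]"
  have a1: "a \<noteq> \<one>"
    using a one_notin_irreds by auto
  obtain m W where mW: "p = (m, W)" "m \<in> carrier M1"
    using p by (cases p) auto
  show "p = (\<one>, [])"
  proof (cases g)
    case (Inl b)
    then have b: "b \<in> irreds M1" "b \<otimes> m = a" "W = []"
      using g eq mW a by auto
    then show ?thesis
      using irreducible_factor[of b m] a mW one_notin_irreds by auto
  next
    case (Inr y)
    then have y: "y \<in> irreds M2" "xval y \<otimes> m = a" "W = []"
      using g eq mW a a1 by (auto split: if_splits)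
    then show ?thesis
      using irreducible_factor[of "xval y" m] a mW xw_ne by auto
  qed
qed

text \<open>The pair is \<open>(\<one>, [y])\<close>. Multiplication by a nontrivial element cannot
  leave a trivial first component, so the last step prepended \<open>y\<close> to the empty
  word.\<close>

lemma Inr_irreducible:
  assumes y: "y \<in> irreds M2" and "\<not> collapses y []"
  shows "c [Inr y] \<in> irreds P"
proof (rule irreducible_if_cover)
  show "[Inr y] \<in> lists gens" "nf [Inr y] \<noteq> (\<one>, [])"
    using assms by auto
next
  fix g :: "'a + 'b" and p :: "'a \<times> 'b list"
  assume g: "g \<in> gens" and p: "fst p \<in> carrier M1" and "act g p = nf [Inr y]"
  then have eq: "act g p = (\<one>, [y])"
    using assms by simp
  obtain m W where mW: "p = (m, W)" "m \<in> carrier M1"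
    using p by (cases p) auto
  show "p = (\<one>, [])"
    using g eq mW one_notin_irreds xw_ne
    by (auto simp: mult_eq_one split: if_splits)
qed

lemma atomic_P: "atomic P"
proof -
  interpret P: monoid P by (rule monoid_P)
  show ?thesis
  proof (rule P.atomic_of_generators[of "(\<lambda>g. c [g]) ` gens"])
    show "(\<lambda>g. c [g]) ` gens \<subseteq> carrier P"
      by (auto simp: carrier_P)
  next
    fix a assume "a \<in> carrier P"
    then obtain w where w: "w \<in> lists gens" "a = c w"
      unfolding carrier_P by blast
    then have "map (\<lambda>g. c [g]) w \<in> lists ((\<lambda>g. c [g]) ` gens)"
      by (auto simp: lists_image)
    then show "\<exists>v\<in>lists ((\<lambda>g. c [g]) ` gens). word_prod P v = a"
      using w word_prod_P by blast
  next
    fix h assume "h \<in> (\<lambda>g. c [g]) ` gens"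
    then obtain g where g: "g \<in> gens" "h = c [g]" by blast
    have irred: "\<exists>v\<in>lists (irreds P). word_prod P v = h" if "c [g] \<in> irreds P"
      using that g word_prod_P[of "[g]"] by (intro bexI[of _ "[h]"]) auto
    show "\<exists>v\<in>lists (irreds P). word_prod P v = h"
    proof (cases "\<exists>y. g = Inr y \<and> collapses y []")
      case False
      then show ?thesis
        using g irred Inl_irreducible Inr_irreducible by auto
    next
      case True
      then obtain y where y: "g = Inr y" "collapses y []" "y \<in> irreds M2"
        using g by auto
      \<comment> \<open>Such a \<open>y\<close> is replaced by the word \<open>xw y\<close>, whose
        letters are irreducible in the convolution.\<close>
      have "[g] \<approx> map Inl (xw y)"
        using cong_collapse[OF y(3) _ y(2)] y(1) by simp
      then have "h = c (map Inl (xw y))"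
        using g by (metis cls_eq_iff pres_cong_in_lists)
      also have "\<dots> = word_prod P (map (\<lambda>g. c [g]) (map Inl (xw y)))"
        using xw_in[OF y(3)] by (intro word_prod_P[symmetric] map_Inl_in)
      finally show ?thesis
        using xw_in[OF y(3)] Inl_irreducible
        by (intro bexI) (auto simp: in_lists_conv_set)
    qed
  qed
qed

text \<open>All defining relations preserve length: those in \<open>R1\<close> by homogeneity of
  \<open>M1\<close>, the others because each \<open>xw y\<close> is a single letter.\<close>

lemma homogeneous_P:
  assumes hom: "homogeneous M1" and irr: "\<And>y. y \<in> irreds M2 \<Longrightarrow> xval y \<in> irreds M1"
  shows "homogeneous P"
proof -
  have len: "length u = length v"
    if "u \<in> lists (irreds M1)" "v \<in> lists (irreds M1)" "word_prod M1 u = word_prod M1 v" for u v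
    using hom that unfolding homogeneous_def by blast
  \<comment> \<open>As \<open>xval y\<close> is irreducible, the one-letter word
    \<open>[xval y]\<close> is a factorization of the same element.\<close>
  have len_xw: "length (xw y) = 1" if "y \<in> irreds M2" for y
    using len[of "xw y" "[xval y]"] irr[OF that] xw_in[OF that] by simp
  have len_R1: "length u = length v" if "(u, v) \<in> R1" for u v
  proof -
    have uv: "u \<in> lists (irreds M1)" "v \<in> lists (irreds M1)"
      using that presentation unfolding presentation_of_def by auto
    moreover have "word_prod M1 u = word_prod M1 v"
      using uv presentation pres_cong.rel[OF that uv] unfolding presentation_of_def by blast
    ultimately show ?thesis by (rule len)
  qed
  show ?thesis
    unfolding convolution_def
  proof (rule homogeneous_presented)
    show "length u = length v" if "(u, v) \<in> rels" for u v
      using that len_xw len_R1 unfolding conv_rels_def by auto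
    show "atomic (presented_monoid gens rels)"
      using atomic_P unfolding convolution_def .
  qed
qed

end

theorem theorem5p3:
  fixes M1 :: "('a, 'm) monoid_scheme" and M2 :: "('b, 'n) monoid_scheme"
    and R1 :: "('a list \<times> 'a list) set" and R2 :: "('b list \<times> 'b list) set"
    and z :: 'b and x :: "'b \<Rightarrow> 'a" and xw :: "'b \<Rightarrow> 'a list"
  assumes "monoid M1" and "presentation_of M1 (irreds M1) R1"
    and "free_0_monoid M2 z R2"
    and "x \<in> irreds M2 \<rightarrow> carrier M1 - {\<one>\<^bsub>M1\<^esub>}"
    and "\<forall>y\<in>irreds M2. xw y \<in> lists (irreds M1) \<and> word_prod M1 (xw y) = x y"
  shows "(atomic M1 \<and> left_cancellative M1 \<and> invertible_free M1 \<longrightarrow>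
            monoid (convolution M1 R1 M2 z R2 xw) \<and>
            atomic (convolution M1 R1 M2 z R2 xw) \<and>
            left_cancellative (convolution M1 R1 M2 z R2 xw) \<and>
            invertible_free (convolution M1 R1 M2 z R2 xw)) \<and>
         (left_cancellative M1 \<and> homogeneous M1 \<and> x ` irreds M2 \<subseteq> irreds M1 \<longrightarrow>
            monoid (convolution M1 R1 M2 z R2 xw) \<and>
            left_cancellative (convolution M1 R1 M2 z R2 xw) \<and>
            homogeneous (convolution M1 R1 M2 z R2 xw))"
proof -
  have data: "convolution_data M1 R1 M2 xw" if "invertible_free M1"
    using assms that
    by (auto simp: convolution_data_def convolution_data_axioms_def Pi_iff)
  show ?thesis
  proof (intro conjI impI; elim conjE)
    assume "left_cancellative M1" "invertible_free M1"
    then interpret convolution_data M1 R1 M2 z R2 xw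
      using data by blast
    show "monoid P" "atomic P" "left_cancellative P" "invertible_free P"
      using monoid_P atomic_P left_cancellative_P invertible_free_P \<open>left_cancellative M1\<close>
      by blast+
  next
    assume *: "left_cancellative M1" "homogeneous M1" "x ` irreds M2 \<subseteq> irreds M1"
    then interpret convolution_data M1 R1 M2 z R2 xw
      using data homogeneous_invertible_free assms(1) by blast
    have "xval y \<in> irreds M1" if "y \<in> irreds M2" for y
      using that * assms(5) by auto
    then show "monoid P" "left_cancellative P" "homogeneous P"
      using monoid_P left_cancellative_P homogeneous_P * by blast+
  qed
qed

end
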